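(* For every graph $G$ the following are equivalent: (i) every induced subgraph $H$ of $G$ satisfies $\tau_c(H) \leq \frac{4}{3}\,\tau(H)$; (ii) $G$ contains neither $P_5$ nor $C_4$ as an induced subgraph.
   Context: All graphs are finite and simple. A vertex cover of $G$ is a set $C \subseteq V(G)$ meeting every edge; $\tau(G)$ is the minimum size of a vertex cover. A connected vertex cover of $G$ is a vertex cover $C$ such that $G[C]$ is connected (if $G$ is disconnected, $G[C]$ must have the same number of connected components as $G$); $\tau_c(G)$ is its minimum size. $P_k$ denotes the path on $k$ vertices and $C_k$ the cycle on $k$ vertices.
   Formalization: Isolated vertices of G are disregarded when G is tested for connectedness and its components are counted in the definition of a connected vertex cover; literally, two isolated vertices would have τ_c = 2 > 0 = τ, making the claim false. *)

theory Defs
  imports Complex_Main "Graph_Theory.Digraph_Isomorphism"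
begin

text \<open>Finite simple graphs are the symmetric digraphs of locale \<^locale>\<open>graph\<close>. Since these are
  symmetric, their strongly connected components are their connected components.\<close>

definition vertex_cover :: "('a, 'b) pre_digraph \<Rightarrow> 'a set \<Rightarrow> bool" where
  "vertex_cover G C \<longleftrightarrow>
     C \<subseteq> verts G \<and> (\<forall>e \<in> arcs G. tail G e \<in> C \<or> head G e \<in> C)"

definition vertex_cover_number :: "('a, 'b) pre_digraph \<Rightarrow> nat" ("\<tau>") where
  "\<tau> G = Min (card ` {C. vertex_cover G C})"

definition num_components :: "('a, 'b) pre_digraph \<Rightarrow> nat" where
  "num_components G = card (pre_digraph.sccs G)"

definition remove_isolated :: "('a, 'b) pre_digraph \<Rightarrow> ('a, 'b) pre_digraph" where
  "remove_isolated G = G \<restriction> {v \<in> verts G. \<exists>w. v \<rightarrow>\<^bsub>G\<^esub> w}"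

text \<open>Isolated vertices are disregarded when \<open>G\<close> is tested for connectedness and when its components
  are counted: otherwise every isolated vertex would have to belong to every connected vertex cover,
  and edgeless graphs would have \<open>\<tau> = 0\<close> but \<open>\<tau>\<^sub>c > 0\<close>. The null graph is not
  connected and has no components, so the empty set is a connected vertex cover of an edgeless
  graph.\<close>

definition connected_vertex_cover :: "('a, 'b) pre_digraph \<Rightarrow> 'a set \<Rightarrow> bool" where
  "connected_vertex_cover G C \<longleftrightarrow> vertex_cover G C \<and>
     (if Digraph_Component.connected (remove_isolated G)
      then Digraph_Component.connected (G \<restriction> C)
      else num_components (G \<restriction> C) = num_components (remove_isolated G))"

definition connected_vertex_cover_number :: "('a, 'b) pre_digraph \<Rightarrow> nat" ("\<tau>\<^sub>c") where
  "\<tau>\<^sub>c G = Min (card ` {C. connected_vertex_cover G C})"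

definition path_graph :: "nat \<Rightarrow> nat pair_pre_digraph" where
  "path_graph k = \<lparr> pverts = {..<k},
     parcs = {(i, j). i < k \<and> j < k \<and> (j = Suc i \<or> i = Suc j)} \<rparr>"

text \<open>Meaningful for \<open>k \<ge> 3\<close> only.\<close>

definition cycle_graph :: "nat \<Rightarrow> nat pair_pre_digraph" where
  "cycle_graph k = \<lparr> pverts = {..<k},
     parcs = {(i, j). i < k \<and> j < k \<and> (j = Suc i mod k \<or> i = Suc j mod k)} \<rparr>"

definition contains_induced :: "('a, 'b) pre_digraph \<Rightarrow> ('c, 'd) pre_digraph \<Rightarrow> bool" where
  "contains_induced G F \<longleftrightarrow> (\<exists>H. induced_subgraph H G \<and> digraph_iso F H)"

end

theory Submission
  imports Defs
begin

text \<open>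
  Let \<open>X\<close> be a vertex cover of a connected \<open>P\<^sub>5\<close>-free graph. A vertex \<open>v\<close> that
  reaches as many vertices of \<open>X\<close> as possible inside \<open>X \<union> {v}\<close> reaches all of them:
  otherwise some \<open>w \<notin> X\<close> is adjacent both to what \<open>v\<close> reaches and to the rest of \<open>X\<close>;
  by maximality \<open>v\<close> reaches a vertex that \<open>w\<close> misses, and a shortest path through \<open>v\<close> and \<open>w\<close>
  contains an induced \<open>P\<^sub>5\<close>. Hence \<open>X \<union> {v}\<close> is a connected vertex cover, and
  \<open>card X + 1 \<le> 4/3 * card X\<close> as soon as \<open>card X \<ge> 3\<close>. If \<open>X = {a, b}\<close> with \<open>a\<close>, \<open>b\<close>
  nonadjacent, then excluding \<open>P\<^sub>5\<close> and \<open>C\<^sub>4\<close> leaves \<open>v\<close> as the only neighbour of, say,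
  \<open>a\<close>, and \<open>{v, b}\<close> is a connected vertex cover. Components are treated separately and
  their covers united. Conversely, \<open>P\<^sub>5\<close> and \<open>C\<^sub>4\<close> have vertex covers of size 2,
  but all of these are independent, so \<open>\<tau>\<^sub>c \<ge> 3\<close>.
\<close>

section \<open>Connected covers of symmetric relations\<close>

text \<open>Vacuously true of the empty set, unlike connectedness of a digraph, which asks for a
  vertex.\<close>

definition linked :: "'a rel \<Rightarrow> 'a set \<Rightarrow> bool" where
  "linked E C \<longleftrightarrow> (\<forall>u\<in>C. \<forall>v\<in>C. (u, v) \<in> (Restr E C)\<^sup>*)"

definition covers :: "'a rel \<Rightarrow> 'a set \<Rightarrow> bool" where
  "covers E C \<longleftrightarrow> (\<forall>u v. (u, v) \<in> E \<longrightarrow> u \<in> C \<or> v \<in> C)"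

text \<open>For symmetric irreflexive \<open>E\<close> this pattern forces the five vertices to be distinct;
  in a \<open>C\<^sub>4\<close> the diagonals have to be kept apart explicitly.\<close>

definition induced_P5 :: "'a rel \<Rightarrow> 'a \<Rightarrow> 'a \<Rightarrow> 'a \<Rightarrow> 'a \<Rightarrow> 'a \<Rightarrow> bool" where
  "induced_P5 E a b c d e \<longleftrightarrow>
     (a, b) \<in> E \<and> (b, c) \<in> E \<and> (c, d) \<in> E \<and> (d, e) \<in> E \<and>
     (a, c) \<notin> E \<and> (a, d) \<notin> E \<and> (a, e) \<notin> E \<and> (b, d) \<notin> E \<and> (b, e) \<notin> E \<and> (c, e) \<notin> E"

definition induced_C4 :: "'a rel \<Rightarrow> 'a \<Rightarrow> 'a \<Rightarrow> 'a \<Rightarrow> 'a \<Rightarrow> bool" where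
  "induced_C4 E a b c d \<longleftrightarrow> a \<noteq> c \<and> b \<noteq> d \<and>
     (a, b) \<in> E \<and> (b, c) \<in> E \<and> (c, d) \<in> E \<and> (d, a) \<in> E \<and> (a, c) \<notin> E \<and> (b, d) \<notin> E"

section \<open>Reachability in graphs without an induced path on five vertices\<close>

locale P5_free =
  fixes E :: "'a rel"
  assumes sym: "sym E" and irrefl: "irrefl E"
    and no_P5: "\<not> induced_P5 E a b c d e"
begin

lemma adj_commute: "(u, v) \<in> E \<longleftrightarrow> (v, u) \<in> E"
  using sym by (auto dest: symD)

lemma adj_irrefl [simp]: "(u, u) \<notin> E"
  using irrefl by (auto simp: irrefl_def)

lemma sym_Restr: "sym (Restr E S)"
  by (rule symI) (auto simp: adj_commute)

lemma Restr_reach_sym: "(u, v) \<in> (Restr E S)\<^sup>* \<Longrightarrow> (v, u) \<in> (Restr E S)\<^sup>*"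
  using sym_rtrancl[OF sym_Restr] by (auto dest: symD)

lemma reach_sym: "(u, v) \<in> E\<^sup>* \<Longrightarrow> (v, u) \<in> E\<^sup>*"
  using sym_rtrancl[OF sym] by (auto dest: symD)

lemma Restr_reach_mono:
  "(u, v) \<in> (Restr E S)\<^sup>* \<Longrightarrow> S \<subseteq> T \<Longrightarrow> (u, v) \<in> (Restr E T)\<^sup>*"
  using rtrancl_mono[of "Restr E S" "Restr E T"] by auto

text \<open>A shortest path is induced, so without P5 it has at most three edges. This holds inside
  every \<open>S\<close>, since a P5 induced in the restriction to \<open>S\<close> is also induced
  in \<open>E\<close>.\<close>

lemma reach_within_3:
  assumes "(x, y) \<in> (Restr E S)\<^sup>*"
  shows "x = y \<or> (x, y) \<in> Restr E S \<or> (\<exists>p. (x, p) \<in> Restr E S \<and> (p, y) \<in> Restr E S) \<or>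
    (\<exists>p q. (x, p) \<in> Restr E S \<and> (p, q) \<in> Restr E S \<and> (q, y) \<in> Restr E S)"
  using assms
proof (induction rule: rtrancl_induct)
  case base
  then show ?case by simp
next
  case (step y z)
  from step.IH consider "x = y" | "(x, y) \<in> Restr E S"
    | p where "(x, p) \<in> Restr E S" "(p, y) \<in> Restr E S"
    | p q where "(x, p) \<in> Restr E S" "(p, q) \<in> Restr E S" "(q, y) \<in> Restr E S"
    by blast
  then show ?case
  proof cases
    case (4 p q)
    show ?thesis
    proof (rule ccontr)
      assume far: "\<not> ?thesis"
      \<comment> \<open>Of the six non-edges required, the three at \<open>z\<close> follow from
        \<open>far\<close>; a violation of any of the other three shortens the walk from
        \<open>x\<close> to \<open>z\<close> to at most three steps.\<close>
      then have "induced_P5 E x p q y z \<or> (x, q) \<in> E \<or> (x, y) \<in> E \<or> (p, y) \<in> E"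
        using 4 step.hyps unfolding induced_P5_def by blast
      then show False
        using far 4 step.hyps no_P5[of x p q y z] by blast
    qed
  qed (use step.hyps in blast)+
qed

text \<open>Two vertices outside a cover are nonadjacent, so the part of \<open>X\<close> that a
  best \<open>v\<close> reaches can be left only through a single outside vertex \<open>w\<close>.
  Exchanging \<open>v\<close> for \<open>w\<close> gains something, hence by maximality also loses
  something; a loss and a gain then turn out to be at distance at least four.\<close>

lemma hub_exists:
  assumes fin: "finite X" and X: "X \<subseteq> K" "X \<noteq> {}"
    and closed: "E `` K \<subseteq> K" and conn: "K \<times> K \<subseteq> E\<^sup>*"
    and cover: "covers (Restr E K) X"
  shows "\<exists>v\<in>K. \<forall>x\<in>X. (v, x) \<in> (Restr E (insert v X))\<^sup>*"
proof -
  \<comment> \<open>\<open>R v\<close> is what \<open>v\<close> reaches as a candidate hub. By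
    \<open>R_comp\<close> it is a union of components of the graph induced on
    \<open>X\<close>.\<close>
  define R where "R v = {x \<in> X. (v, x) \<in> (Restr E (insert v X))\<^sup>*}" for v
  have R_le: "card (R v) \<le> card X" for v
    unfolding R_def using fin by (intro card_mono) auto
  have finR: "finite (R v)" for v
    unfolding R_def using fin by simp
  obtain v where v: "v \<in> K" "\<And>w. w \<in> K \<Longrightarrow> card (R w) \<le> card (R v)"
  proof -
    obtain x0 where "x0 \<in> K" using X by auto
    then have "\<exists>v. v \<in> K \<and> (\<forall>w. w \<in> K \<longrightarrow> card (R w) \<le> card (R v))"
      by (rule ex_has_greatest_nat[where b = "Suc (card X)"]) (use R_le in \<open>auto simp: less_Suc_eq_le\<close>)
    then show thesis using that by blast
  qed
  have R_closed: "y \<in> R u" if "x \<in> insert u (R u)" "(x, y) \<in> E" "y \<in> X" for u x y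
  proof -
    have "(u, x) \<in> (Restr E (insert u X))\<^sup>*" "x \<in> insert u X" using that by (auto simp: R_def)
    then show ?thesis using that by (auto simp: R_def intro: rtrancl_into_rtrancl)
  qed
  have R_comp: "y \<in> R u" if "x \<in> R u" "(x, y) \<in> (Restr E X)\<^sup>*" for u x y
    using that(2,1) by (induction rule: rtrancl_induct) (auto intro: R_closed)
  have "R v = X"
  proof (rule ccontr)
    assume "R v \<noteq> X"
    then obtain x1 where x1: "x1 \<in> X" "x1 \<notin> R v" by (auto simp: R_def)
    have "\<exists>w a b. w \<in> K \<and> w \<notin> X \<and> a \<in> R v \<and> (a, w) \<in> E \<and> b \<in> X \<and> b \<notin> R v \<and> (w, b) \<in> E"
    proof (rule ccontr)
      assume none: "\<not> ?thesis"
      define A where "A = insert v (R v)"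
      \<comment> \<open>Invariant of walks from \<open>v\<close>: without such a \<open>w\<close>
        they visit only \<open>v\<close>, \<open>R v\<close> and outside vertices next to
        \<open>R v\<close>. From the last kind, the cover condition forces the next vertex into
        \<open>X\<close>, hence into \<open>R v\<close>.\<close>
      have "y \<in> A \<or> (y \<in> K - X \<and> (\<exists>a\<in>R v. (a, y) \<in> E))" if "(v, y) \<in> E\<^sup>*" for y
        using that
      proof (induction rule: rtrancl_induct)
        case base
        then show ?case by (simp add: A_def)
      next
        case (step y z)
        have yK: "y \<in> K" using step.IH v X by (auto simp: A_def R_def)
        then have zK: "z \<in> K" using step.hyps closed by auto
        have cov: "y \<in> X \<or> z \<in> X" using cover step.hyps yK zK by (auto simp: covers_def)
        from step.IH show ?case
        proof
          assume y: "y \<in> A"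
          show ?thesis
          proof (cases "z \<in> X")
            case True
            then show ?thesis using y step.hyps R_closed[of y v z] by (auto simp: A_def)
          next
            case False
            then have "y \<in> R v" using y cov by (auto simp: A_def R_def)
            then show ?thesis using step.hyps zK False by auto
          qed
        next
          assume y: "y \<in> K - X \<and> (\<exists>a\<in>R v. (a, y) \<in> E)"
          then have "z \<in> R v" using none cov step.hyps by blast
          then show ?thesis by (simp add: A_def)
        qed
      qed
      moreover have "(v, x1) \<in> E\<^sup>*" using conn v x1 X by auto
      moreover have "v \<in> X \<Longrightarrow> v \<in> R v" by (simp add: R_def)
      ultimately show False using x1 by (auto simp: A_def)
    qed
    then obtain w a b where w: "w \<in> K" "w \<notin> X" "a \<in> R v" "(a, w) \<in> E" "b \<in> X" "b \<notin> R v" "(w, b) \<in> E"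
      by blast
    have aX: "a \<in> X" using w by (auto simp: R_def)
    have aw: "a \<in> R w" and bw: "b \<in> R w" using R_closed[of w w] w aX by (auto simp: adj_commute)
    \<comment> \<open>\<open>w\<close> reaches \<open>b\<close>, which \<open>v\<close> does not, so
      a gain without a loss would contradict the choice of \<open>v\<close>.\<close>
    have "\<not> R v \<subseteq> R w"
    proof
      assume "R v \<subseteq> R w"
      then have "R v \<subset> R w" using bw w by blast
      from psubset_card_mono[OF finR this] v(2)[OF w(1)] show False by simp
    qed
    then obtain c where c: "c \<in> R v" "c \<notin> R w" by blast
    have cX: "c \<in> X" using c by (auto simp: R_def)
    let ?D = "{y. (a, y) \<in> (Restr E X)\<^sup>*}"
    \<comment> \<open>Otherwise \<open>R v\<close> would be a single component of \<open>X\<close>,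
      which \<open>w\<close> touches at \<open>a\<close>, and \<open>w\<close> would reach
      \<open>c\<close>.\<close>
    have vX: "v \<notin> X"
    proof
      assume "v \<in> X"
      then have "insert v X = X" by auto
      then have "(a, v) \<in> (Restr E X)\<^sup>*" "(v, c) \<in> (Restr E X)\<^sup>*"
        using w(3) c(1) Restr_reach_sym[of v a X] by (simp_all add: R_def)
      then show False using R_comp[OF aw] c by (meson rtrancl_trans)
    qed
    \<comment> \<open>After its last visit to \<open>v\<close>, a path to \<open>x\<close> stays
      inside \<open>X\<close>.\<close>
    have touch: "\<exists>y. (v, y) \<in> E \<and> (y, x) \<in> (Restr E X)\<^sup>*" if "x \<in> R v" for x
    proof -
      have "(v, x) \<in> (Restr E (insert v X))\<^sup>*" using that by (simp add: R_def)
      moreover have "x \<noteq> v" using that vX by (auto simp: R_def)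
      moreover have "x = v \<or> (\<exists>y\<in>X. (v, y) \<in> E \<and> (y, x) \<in> (Restr E X)\<^sup>* \<and> x \<in> X)"
        if "(v, x) \<in> (Restr E (insert v X))\<^sup>*" for x
        using that
      proof (induction rule: rtrancl_induct)
        case (step y z)
        then show ?case by (cases "z = v") (auto intro: rtrancl_into_rtrancl)
      qed simp
      ultimately show ?thesis by blast
    qed
    obtain c' where c': "(v, c') \<in> E" "(c', c) \<in> (Restr E X)\<^sup>*" using touch[OF c(1)] by blast
    obtain a' where a': "(v, a') \<in> E" "(a', a) \<in> (Restr E X)\<^sup>*" using touch[OF w(3)] by blast
    have c'X: "c' \<in> X" using c'(2) cX by (induction rule: converse_rtrancl_induct) auto
    have c'Rv: "c' \<in> R v" using R_comp[OF c(1)] Restr_reach_sym[OF c'(2)] by blast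
    have c'Rw: "c' \<notin> R w" using R_comp[OF _ c'(2), of w] c(2) by blast
    have D_Rv: "?D \<subseteq> R v" and D_Rw: "?D \<subseteq> R w" using R_comp w aw by auto
    have a'D: "a' \<in> ?D" using Restr_reach_sym[OF a'(2)] by simp
    \<comment> \<open>The component \<open>?D\<close> of \<open>a\<close> in \<open>X\<close> joins
      \<open>v\<close> to \<open>w\<close>. Within \<open>S\<close>, the only neighbour of
      \<open>c'\<close> is \<open>v\<close> and the only neighbour of \<open>b\<close> is
      \<open>w\<close>, while \<open>v\<close> and \<open>w\<close> are distinct and nonadjacent. So
      \<open>c'\<close> and \<open>b\<close> are joined in \<open>S\<close>, but not within three
      steps.\<close>
    define S where "S = {c', v, w, b} \<union> ?D"
    have D_path: "(a, y) \<in> (Restr E S)\<^sup>*" if "(a, y) \<in> (Restr E X)\<^sup>*" for y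
      using that
    proof (induction rule: rtrancl_induct)
      case (step y z)
      then have "z \<in> ?D" by (auto intro: rtrancl_into_rtrancl)
      then have "(y, z) \<in> Restr E S" using step by (auto simp: S_def)
      then show ?case using step.IH by (rule rtrancl_into_rtrancl[rotated])
    qed simp
    have "(c', v) \<in> Restr E S" "(v, a') \<in> Restr E S" "(a, w) \<in> Restr E S" "(w, b) \<in> Restr E S"
      using c' a' w a'D by (auto simp: S_def adj_commute)
    moreover have "(a', a) \<in> (Restr E S)\<^sup>*" using D_path a'D Restr_reach_sym by blast
    ultimately have reach: "(c', b) \<in> (Restr E S)\<^sup>*"
      by (meson converse_rtrancl_into_rtrancl rtrancl_into_rtrancl)
    have vw: "(v, w) \<notin> E" "(w, v) \<notin> E" using cover v w vX by (auto simp: covers_def adj_commute)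
    \<comment> \<open>Being outside \<open>R w\<close>, the vertex \<open>c'\<close> misses
      \<open>w\<close> and also \<open>?D\<close>, which is part of \<open>R w\<close>; being in
      \<open>R v\<close>, it misses \<open>b\<close>.\<close>
    have c'_nb: "y = v" if "(c', y) \<in> Restr E S" for y
    proof (rule ccontr)
      assume "y \<noteq> v"
      with that consider "y = w" | "y = b" | "y \<in> ?D" by (auto simp: S_def)
      then show False
      proof cases
        case 1
        then show ?thesis using that R_closed[of w w c'] c'X c'Rw by (auto simp: adj_commute)
      next
        case 2
        then show ?thesis using that R_closed[of c' v b] c'Rv w by auto
      next
        case 3
        then show ?thesis using that D_Rw R_closed[of y w c'] c'X c'Rw by (auto simp: adj_commute)
      qed
    qed
    have b_nb: "y = w" if "(y, b) \<in> Restr E S" for y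
    proof (rule ccontr)
      assume "y \<noteq> w"
      with that consider "y = v" | "y = c'" | "y \<in> ?D" by (auto simp: S_def)
      then show False using that R_closed[of y v b] c'Rv D_Rv w by cases auto
    qed
    have "c' \<noteq> b" using c'Rv w by auto
    moreover have "v \<noteq> w" using c'Rv c'Rw by auto
    moreover have "v \<noteq> b" using w(5) vX by auto
    ultimately show False using reach_within_3[OF reach] c'_nb b_nb vw(1) by auto
  qed
  then show ?thesis using v by (auto simp: R_def)
qed

end

section \<open>Small connected covers once induced four-cycles are excluded as well\<close>

locale P5_C4_free = P5_free +
  assumes no_C4: "\<not> induced_C4 E a b c d"
begin

text \<open>Adding the hub costs one vertex, which the ratio allows from three vertices on. For one
  or two vertices there is no slack, and a linked cover that is no larger than \<open>X\<close> has
  to be found; C4-freeness enters only here.\<close>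

lemma linked_cover_component:
  assumes fin: "finite X" and X: "X \<subseteq> K" "X \<noteq> {}"
    and closed: "E `` K \<subseteq> K" and conn: "K \<times> K \<subseteq> E\<^sup>*"
    and cover: "covers (Restr E K) X"
  shows "\<exists>C\<subseteq>K. C \<noteq> {} \<and> covers (Restr E K) C \<and> linked E C \<and> 3 * card C \<le> 4 * card X"
proof -
  obtain v where v: "v \<in> K" and hub: "\<And>x. x \<in> X \<Longrightarrow> (v, x) \<in> (Restr E (insert v X))\<^sup>*"
    using hub_exists[OF assms] by blast
  have lk: "linked E (insert v X)"
  proof -
    have "(v, x) \<in> (Restr E (insert v X))\<^sup>*" if "x \<in> insert v X" for x
      using that hub by auto
    then show ?thesis unfolding linked_def by (blast intro: Restr_reach_sym rtrancl_trans)
  qed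
  have card_pos: "card X > 0" using fin X by (simp add: card_gt_0_iff)
  show ?thesis
  proof (cases "v \<in> X \<or> card X \<ge> 3")
    case True
    have "3 * card (insert v X) \<le> 4 * card X"
      using True fin by (auto simp: insert_absorb card_insert_if)
    moreover have "covers (Restr E K) (insert v X)" using cover by (auto simp: covers_def)
    ultimately show ?thesis using lk v X by (intro exI[of _ "insert v X"]) auto
  next
    case False
    then have vX: "v \<notin> X" and "card X = 1 \<or> card X = 2" using card_pos by auto
    from this(2) show ?thesis
    proof
      assume "card X = 1"
      then obtain x where "X = {x}" by (auto simp: card_1_singleton_iff)
      then show ?thesis using cover X by (intro exI[of _ X]) (auto simp: linked_def)
    next
      assume two: "card X = 2"
      then obtain a b where ab: "X = {a, b}" "a \<noteq> b" by (auto simp: card_2_iff)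
      show ?thesis
      proof (cases "(a, b) \<in> E")
        case True
        then have "linked E X" using ab by (auto simp: linked_def adj_commute intro!: r_into_rtrancl)
        then show ?thesis using cover X two by (intro exI[of _ X]) auto
      next
        case nadj: False
        \<comment> \<open>As \<open>a\<close> and \<open>b\<close> are nonadjacent, the first step
          from either of them towards \<open>v\<close> must already end in \<open>v\<close>.\<close>
        have first: "\<exists>y. (x, y) \<in> E \<and> y \<in> insert v X" if "x \<in> X" for x
        proof -
          have "(x, v) \<in> (Restr E (insert v X))\<^sup>*" using hub[OF that] by (rule Restr_reach_sym)
          then show ?thesis by (rule converse_rtranclE) (use that vX in auto)
        qed
        have av: "(a, v) \<in> E" "(b, v) \<in> E"
          using first[of a] first[of b] ab nadj adj_commute[of a b] by auto
        have out: "(p, v) \<notin> E" if "p \<notin> X" "p \<in> K" for p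
          using cover that v vX by (auto simp: covers_def)
        \<comment> \<open>\<open>v\<close> takes over all edges at \<open>x\<close>, and
          \<open>v\<close>, \<open>y\<close> are adjacent.\<close>
        have single: "\<exists>C\<subseteq>K. C \<noteq> {} \<and> covers (Restr E K) C \<and> linked E C \<and> 3 * card C \<le> 4 * card X"
          if "\<And>p. (p, x) \<in> E \<Longrightarrow> p = v" "X = {x, y}" "(y, v) \<in> E" for x y
        proof (intro exI[of _ "{v, y}"] conjI)
          show "covers (Restr E K) {v, y}"
            using cover that(1)[OF symD[OF sym]] that(1,2) unfolding covers_def by blast
          show "linked E {v, y}"
            using that by (auto simp: linked_def adj_commute intro!: r_into_rtrancl)
          have "card {v, y} \<le> 2" by (simp add: card_insert_if)
          then show "3 * card {v, y} \<le> 4 * card X" using two by simp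
        qed (use that v X in auto)
        show ?thesis
        proof (cases "(\<forall>p. (p, a) \<in> E \<longrightarrow> p = v) \<or> (\<forall>p. (p, b) \<in> E \<longrightarrow> p = v)")
          case True
          then show ?thesis using single[of a b] single[of b a] ab av by (auto simp: insert_commute)
        next
          case False
          then obtain p q where pq: "(p, a) \<in> E" "p \<noteq> v" "(q, b) \<in> E" "q \<noteq> v" by blast
          have K: "p \<in> K" "q \<in> K" using pq closed X ab by (auto simp: adj_commute)
          have X': "p \<notin> X" "q \<notin> X" using pq ab nadj by (auto simp: adj_commute)
          have pq': "(a, p) \<in> E" "(b, q) \<in> E" and av': "(v, a) \<in> E" "(v, b) \<in> E"
            using pq av sym by (blast dest: symD)+
          \<comment> \<open>An edge from \<open>p\<close> to \<open>b\<close> or from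
            \<open>a\<close> to \<open>q\<close> would close an induced C4 through \<open>v\<close>;
            this also excludes \<open>p = q\<close>. Without these edges \<open>p a v b q\<close> is
            an induced P5.\<close>
          have "(p, q) \<notin> E" using K X' cover by (auto simp: covers_def)
          moreover have pv: "(p, v) \<notin> E" and qv: "(q, v) \<notin> E" using out K X' by auto
          moreover have "(v, q) \<notin> E" using qv sym by (blast dest: symD)
          moreover have "(p, b) \<notin> E"
            using no_C4[of a p b v] pq pq' av av' ab(2) nadj pv by (simp add: induced_C4_def)
          moreover have "(a, q) \<notin> E"
            using no_C4[of a q b v] pq pq' av av' ab(2) nadj qv by (simp add: induced_C4_def)
          ultimately have "induced_P5 E p a v b q"
            using pq pq' av av' nadj by (simp add: induced_P5_def)
          then show ?thesis using no_P5[of p a v b q] by simp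
        qed
      qed
    qed
  qed
qed

text \<open>Each component gets its own cover, and disjointness lets the bounds add up. The cover
  stays inside \<open>Field E\<close> because its components are later matched with those of the
  graph without isolated vertices.\<close>

lemma linked_cover_exists:
  assumes fin: "finite X" and cover: "covers E X"
  shows "\<exists>C\<subseteq>Field E. covers E C \<and> (\<forall>u\<in>C. \<forall>v\<in>C. (u, v) \<in> E\<^sup>* \<longrightarrow> (u, v) \<in> (Restr E C)\<^sup>*) \<and>
    3 * card C \<le> 4 * card X"
proof -
  \<comment> \<open>These are the components that carry an edge: each contains a vertex of
    \<open>X\<close>, and isolated vertices of \<open>X\<close> are dropped.\<close>
  define comps where "comps = (\<lambda>x. E\<^sup>* `` {x}) ` (X \<inter> Field E)"
  have comp_eq: "E\<^sup>* `` {x} = E\<^sup>* `` {y}" if "(x, y) \<in> E\<^sup>*" for x y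
    using that by (auto intro: rtrancl_trans dest: reach_sym)
  have comp_reach: "K = E\<^sup>* `` {u}" if "K \<in> comps" "u \<in> K" for K u
  proof -
    obtain x where x: "K = E\<^sup>* `` {x}" using \<open>K \<in> comps\<close> by (auto simp: comps_def)
    then show ?thesis using comp_eq[of x u] \<open>u \<in> K\<close> by simp
  qed
  have disj: "K \<inter> L = {}" if "K \<in> comps" "L \<in> comps" "K \<noteq> L" for K L
    using that comp_reach by blast
  have Fld: "y \<in> Field E" if "(x, y) \<in> E\<^sup>*" "x \<in> Field E" for x y
    using that by (induction rule: rtrancl_induct) (auto simp: Field_def)
  have "\<exists>C\<subseteq>K. C \<noteq> {} \<and> covers (Restr E K) C \<and> linked E C \<and> 3 * card C \<le> 4 * card (X \<inter> K)"
    if K: "K \<in> comps" for K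
  proof (rule linked_cover_component)
    show "X \<inter> K \<noteq> {}" using K by (auto simp: comps_def)
    show "E `` K \<subseteq> K" using K by (auto simp: comps_def intro: rtrancl_into_rtrancl)
    show "K \<times> K \<subseteq> E\<^sup>*"
      using K by (auto simp: comps_def intro: rtrancl_trans dest: reach_sym)
    show "covers (Restr E K) (X \<inter> K)" using cover by (auto simp: covers_def)
  qed (use fin in auto)
  then obtain f where "\<forall>K\<in>comps. f K \<subseteq> K \<and> f K \<noteq> {} \<and> covers (Restr E K) (f K) \<and>
      linked E (f K) \<and> 3 * card (f K) \<le> 4 * card (X \<inter> K)"
    using bchoice[of comps "\<lambda>K C. C \<subseteq> K \<and> C \<noteq> {} \<and> covers (Restr E K) C \<and>
      linked E C \<and> 3 * card C \<le> 4 * card (X \<inter> K)"] by blast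
  then have f: "\<And>K. K \<in> comps \<Longrightarrow> f K \<subseteq> K" "\<And>K. K \<in> comps \<Longrightarrow> covers (Restr E K) (f K)"
      "\<And>K. K \<in> comps \<Longrightarrow> linked E (f K)" "\<And>K. K \<in> comps \<Longrightarrow> 3 * card (f K) \<le> 4 * card (X \<inter> K)"
    by auto
  let ?C = "\<Union>(f ` comps)"
  have fc: "finite comps" using fin by (simp add: comps_def)
  have "covers E ?C"
    unfolding covers_def
  proof (intro allI impI)
    fix u v assume uv: "(u, v) \<in> E"
    obtain K where K: "K \<in> comps" "u \<in> K" "v \<in> K"
    proof (cases "u \<in> X")
      case True
      then show ?thesis using uv by (intro that[of "E\<^sup>* `` {u}"]) (auto simp: comps_def Field_def)
    next
      case False
      then have "v \<in> X" using uv cover by (auto simp: covers_def)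
      then show ?thesis using uv
        by (intro that[of "E\<^sup>* `` {v}"]) (auto simp: comps_def Field_def adj_commute)
    qed
    then show "u \<in> ?C \<or> v \<in> ?C" using f(2)[OF K(1)] uv by (auto simp: covers_def)
  qed
  moreover have "(u, v) \<in> (Restr E ?C)\<^sup>*"
    if uv: "u \<in> ?C" "v \<in> ?C" "(u, v) \<in> E\<^sup>*" for u v
  proof -
    obtain K L where K: "K \<in> comps" "u \<in> f K" and L: "L \<in> comps" "v \<in> f L" using uv by auto
    have "v \<in> K" using comp_reach[of K u] K f(1) uv by auto
    then have "K = L" using disj[of K L] K L f(1) by blast
    then have "(u, v) \<in> (Restr E (f K))\<^sup>*" using f(3)[OF K(1)] K L by (auto simp: linked_def)
    then show ?thesis by (rule Restr_reach_mono) (use K in auto)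
  qed
  moreover have "3 * card ?C \<le> 4 * card X"
  proof -
    have "3 * card ?C \<le> (\<Sum>K\<in>comps. 3 * card (f K))"
      using card_UN_le[OF fc, of f] by (simp flip: sum_distrib_left)
    also have "\<dots> \<le> (\<Sum>K\<in>comps. 4 * card (X \<inter> K))" by (intro sum_mono f(4))
    also have "\<dots> = 4 * card (\<Union>K\<in>comps. X \<inter> K)"
      using fin fc disj by (subst card_UN_disjoint) (auto simp: sum_distrib_left)
    also have "\<dots> \<le> 4 * card X" using fin by (intro mult_le_mono card_mono) auto
    finally show ?thesis .
  qed
  moreover have "K \<subseteq> Field E" if "K \<in> comps" for K
    using that Fld by (auto simp: comps_def)
  then have "?C \<subseteq> Field E" using f(1) by blast
  ultimately show ?thesis by (intro exI[of _ ?C]) blast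
qed

end

section \<open>Connected vertex covers of graphs\<close>

lemma arcs_ends_induce: "arcs_ends (G \<restriction> S) = Restr (arcs_ends G) S"
  by (auto simp: arcs_ends_conv)

lemma vertex_cover_iff_covers:
  "vertex_cover G C \<longleftrightarrow> C \<subseteq> verts G \<and> covers (arcs_ends G) C"
  by (auto simp: vertex_cover_def covers_def arcs_ends_conv)

context graph
begin

lemma graph_induced: "induced_subgraph H G \<Longrightarrow> graph H"
  using digraphI_induced induced_graph_imp_symmetric[OF sym_arcs] digraph.graphI by blast

lemma sym_arcs_ends: "sym (arcs_ends G)"
  using sym_arcs by (simp add: symmetric_def)

lemma irrefl_arcs_ends: "irrefl (arcs_ends G)"
  using adj_not_same by (auto simp: irrefl_def)

lemma Field_arcs_ends: "Field (arcs_ends G) = {v \<in> verts G. \<exists>w. v \<rightarrow>\<^bsub>G\<^esub> w}"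
  using sym_arcs_ends by (auto simp: Field_def dest: adj_in_verts symD)

lemma connected_iff:
  "Digraph_Component.connected G \<longleftrightarrow>
     verts G \<noteq> {} \<and> (\<forall>u\<in>verts G. \<forall>v\<in>verts G. (u, v) \<in> (arcs_ends G)\<^sup>*)"
proof -
  have "symcl (arcs_ends G) = arcs_ends G"
    using sym_arcs_ends by (auto simp: symcl_def dest: symD)
  moreover have "(u, v) \<in> rtrancl_on (verts G) (arcs_ends G) \<longleftrightarrow> (u, v) \<in> (arcs_ends G)\<^sup>*"
    if "u \<in> verts G" for u v
    using reachable_conv'[OF that] by (simp add: reachable_def)
  ultimately show ?thesis by (simp add: connected_conv)
qed

lemma num_components_eq:
  "num_components G = card ((\<lambda>u. (arcs_ends G)\<^sup>* `` {u}) ` verts G)"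
proof -
  have "scc_of u = (arcs_ends G)\<^sup>* `` {u}" if "u \<in> verts G" for u
    using that reachable_conv'[OF that] symmetric_reachable'
    by (auto simp: scc_of_def)
  then show ?thesis
    using card_sccs_verts sccs_verts_conv_scc_of by (simp add: num_components_def)
qed

lemma finite_vertex_covers: "finite {C. vertex_cover G C}"
  by (rule finite_subset[of _ "Pow (verts G)"]) (auto simp: vertex_cover_def)

lemma minimum_vertex_cover:
  obtains C where "vertex_cover G C" "card C = \<tau> G"
proof -
  have "vertex_cover G (verts G)" by (auto simp: vertex_cover_def)
  then have "Min (card ` {C. vertex_cover G C}) \<in> card ` {C. vertex_cover G C}"
    using finite_vertex_covers by (intro Min_in) auto
  then show thesis using that by (auto simp: vertex_cover_number_def)
qed

lemma vertex_cover_number_le: "vertex_cover G C \<Longrightarrow> \<tau> G \<le> card C"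
  using finite_vertex_covers by (auto simp: vertex_cover_number_def)

lemma finite_connected_vertex_covers: "finite {C. connected_vertex_cover G C}"
  by (rule finite_subset[OF _ finite_vertex_covers]) (auto simp: connected_vertex_cover_def)

lemma connected_vertex_cover_number_le: "connected_vertex_cover G C \<Longrightarrow> \<tau>\<^sub>c G \<le> card C"
  using finite_connected_vertex_covers by (auto simp: connected_vertex_cover_number_def)

text \<open>The witness \<open>D\<close> keeps \<open>Min\<close> away from the empty set, where its
  value is unspecified.\<close>

lemma minimum_connected_vertex_cover:
  assumes "connected_vertex_cover G D"
  obtains C where "connected_vertex_cover G C" "card C = \<tau>\<^sub>c G"
proof -
  have "Min (card ` {C. connected_vertex_cover G C}) \<in> card ` {C. connected_vertex_cover G C}"
    using finite_connected_vertex_covers assms by (intro Min_in) auto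
  then show thesis using that by (auto simp: connected_vertex_cover_number_def)
qed

text \<open>A non-isolated vertex lies on an edge, and \<open>C\<close> covers that edge, so every
  component with an edge meets \<open>C\<close>; by \<open>conn\<close> its trace on
  \<open>C\<close> is a component of the graph induced on \<open>C\<close>. This serves both
  branches of the definition, the second one by counting traces.\<close>

lemma connected_vertex_coverI:
  assumes C: "C \<subseteq> Field (arcs_ends G)" and cover: "covers (arcs_ends G) C"
    and conn: "\<And>u v. u \<in> C \<Longrightarrow> v \<in> C \<Longrightarrow> (u, v) \<in> (arcs_ends G)\<^sup>* \<Longrightarrow>
      (u, v) \<in> (Restr (arcs_ends G) C)\<^sup>*"
  shows "connected_vertex_cover G C"
proof -
  let ?E = "arcs_ends G" and ?N = "Field (arcs_ends G)"
  have vC: "C \<subseteq> verts G" and vN: "?N \<subseteq> verts G" using C by (auto simp: Field_arcs_ends)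
  interpret HC: graph "G \<restriction> C" using vC by (intro graph_induced induced_induce)
  interpret HN: graph "G \<restriction> ?N" using vN by (intro graph_induced induced_induce)
  have R: "remove_isolated G = G \<restriction> ?N" by (simp add: remove_isolated_def Field_arcs_ends)
  have EN: "arcs_ends (G \<restriction> ?N) = ?E" by (auto simp: arcs_ends_induce Field_def)
  have EC: "arcs_ends (G \<restriction> C) = Restr ?E C" by (rule arcs_ends_induce)
  have C_iff: "(u, v) \<in> (Restr ?E C)\<^sup>* \<longleftrightarrow> (u, v) \<in> ?E\<^sup>* \<and> v \<in> C" if "u \<in> C" for u v
  proof
    assume uv: "(u, v) \<in> (Restr ?E C)\<^sup>*"
    have "v \<in> C" using uv by (rule rtranclE) (use that in auto)
    then show "(u, v) \<in> ?E\<^sup>* \<and> v \<in> C" using uv rtrancl_mono[of "Restr ?E C" ?E] by auto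
  qed (use conn that in auto)
  have reach_sym: "(v, u) \<in> ?E\<^sup>*" if "(u, v) \<in> ?E\<^sup>*" for u v
    using sym_rtrancl[OF sym_arcs_ends] that by (rule symD)
  have comp_eq: "?E\<^sup>* `` {u} = ?E\<^sup>* `` {v}" if "(u, v) \<in> ?E\<^sup>*" for u v
    using that reach_sym[OF that] by (auto intro: rtrancl_trans)
  have meets: "\<exists>v\<in>C. (u, v) \<in> ?E\<^sup>*" if uN: "u \<in> ?N" for u
  proof -
    obtain w where "(u, w) \<in> ?E" using uN by (auto simp: Field_arcs_ends)
    then show ?thesis using cover by (auto simp: covers_def)
  qed
  show ?thesis
  proof (cases "Digraph_Component.connected (G \<restriction> ?N)")
    case True
    then have "?N \<noteq> {}" and all: "\<forall>u\<in>?N. \<forall>v\<in>?N. (u, v) \<in> ?E\<^sup>*"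
      by (simp_all add: HN.connected_iff EN)
    then have "C \<noteq> {}" using meets by blast
    moreover have "\<forall>u\<in>C. \<forall>v\<in>C. (u, v) \<in> (Restr ?E C)\<^sup>*" using all C C_iff by auto
    ultimately have "Digraph_Component.connected (G \<restriction> C)"
      unfolding HC.connected_iff EC by simp
    then show ?thesis
      using True vC cover by (simp add: connected_vertex_cover_def vertex_cover_iff_covers R)
  next
    case False
    have "(\<lambda>u. ?E\<^sup>* `` {u}) ` ?N = (\<lambda>u. ?E\<^sup>* `` {u}) ` C" (is "?L = _")
    proof
      show "?L \<subseteq> (\<lambda>u. ?E\<^sup>* `` {u}) ` C"
      proof safe
        fix u assume "u \<in> ?N"
        then obtain v where "v \<in> C" "(u, v) \<in> ?E\<^sup>*" using meets by blast
        then show "?E\<^sup>* `` {u} \<in> (\<lambda>u. ?E\<^sup>* `` {u}) ` C" using comp_eq[of u v] by simp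
      qed
    qed (use C in auto)
    moreover have "(\<lambda>u. (Restr ?E C)\<^sup>* `` {u}) ` C = (\<lambda>S. S \<inter> C) ` ((\<lambda>u. ?E\<^sup>* `` {u}) ` C)"
      unfolding image_image using C_iff by (intro image_cong) auto
    \<comment> \<open>A component is recovered from any vertex of its trace, so distinct components
      have distinct traces.\<close>
    moreover have "inj_on (\<lambda>S. S \<inter> C) ((\<lambda>u. ?E\<^sup>* `` {u}) ` C)"
    proof (rule inj_onI)
      fix S T assume "S \<in> (\<lambda>u. ?E\<^sup>* `` {u}) ` C" "T \<in> (\<lambda>u. ?E\<^sup>* `` {u}) ` C"
        and eq: "S \<inter> C = T \<inter> C"
      then obtain u v where u: "u \<in> C" "S = ?E\<^sup>* `` {u}" and v: "v \<in> C" "T = ?E\<^sup>* `` {v}" by auto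
      have "u \<in> T" using eq u by blast
      then show "S = T" using comp_eq[of v u] u v by simp
    qed
    ultimately have "num_components (G \<restriction> C) = num_components (G \<restriction> ?N)"
      unfolding HC.num_components_eq HN.num_components_eq EC EN by (simp add: card_image)
    then show ?thesis
      using False vC cover by (simp add: connected_vertex_cover_def vertex_cover_iff_covers R)
  qed
qed

text \<open>A digraph isomorphism must map arcs too. Without parallel arcs in \<open>G\<close> the
  ends determine the arc, so an injective vertex map that preserves and reflects adjacency
  suffices.\<close>

lemma contains_inducedI:
  assumes F: "pair_wf_digraph F" and inj: "inj_on f (pverts F)" and sub: "f ` pverts F \<subseteq> verts G"
    and adj: "\<And>u v. u \<in> pverts F \<Longrightarrow> v \<in> pverts F \<Longrightarrow> (u, v) \<in> parcs F \<longleftrightarrow> f u \<rightarrow>\<^bsub>G\<^esub> f v"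
  shows "contains_induced G (with_proj F)"
proof -
  interpret F: pair_wf_digraph F by fact
  \<comment> \<open>\<open>inv_into\<close> selects the arc of \<open>G\<close> with the prescribed
    ends.\<close>
  define g where "g = (\<lambda>(u, v). inv_into (arcs G) (arc_to_ends G) (f u, f v))"
  let ?h = "\<lparr>iso_verts = f, iso_arcs = g, iso_head = head G, iso_tail = tail G\<rparr>"
  have g: "g (u, v) \<in> arcs G" "tail G (g (u, v)) = f u" "head G (g (u, v)) = f v"
    if "(u, v) \<in> parcs F" for u v
  proof -
    have "(f u, f v) \<in> arc_to_ends G ` arcs G"
      using adj[of u v] that F.wellformed'[OF that] by (simp add: arcs_ends_def)
    then have "g (u, v) \<in> arcs G" "arc_to_ends G (g (u, v)) = (f u, f v)"
      unfolding g_def by (auto intro: inv_into_into f_inv_into_f)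
    then show "g (u, v) \<in> arcs G" "tail G (g (u, v)) = f u" "head G (g (u, v)) = f v"
      by (simp_all add: arc_to_ends_def)
  qed
  have "inj_on g (parcs F)"
  proof (rule inj_onI, safe)
    fix u v u' v'
    assume uv: "(u, v) \<in> parcs F" "(u', v') \<in> parcs F" and eq: "g (u, v) = g (u', v')"
    have "f u = f u'" "f v = f v'" using g(2,3)[OF uv(1)] g(2,3)[OF uv(2)] eq by simp_all
    then show "u = u'" "v = v'"
      using inj F.wellformed'[OF uv(1)] F.wellformed'[OF uv(2)] by (auto dest: inj_onD)
  qed
  then have "F.digraph_isomorphism ?h"
    using inj g F.wf_digraph by (auto simp: F.digraph_isomorphism_def)
  moreover have "G \<restriction> (f ` pverts F) = app_iso ?h (with_proj F)"
  proof -
    \<comment> \<open>No arc of the induced subgraph is missed: it is parallel to an arc in the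
      image of \<open>g\<close>, hence equal to it.\<close>
    have "e \<in> g ` parcs F" if e: "e \<in> arcs G" "tail G e = f u" "head G e = f v"
        "u \<in> pverts F" "v \<in> pverts F" for e u v
    proof -
      have uv: "(u, v) \<in> parcs F" using adj[of u v] dominatesI[of e "f u" "f v"] e by (simp add: arc_to_ends_def)
      have "e = g (u, v)" using no_multi_arcs[of e "g (u, v)"] e g[OF uv] by (simp add: arc_to_ends_def)
      then show ?thesis using uv by simp
    qed
    moreover have "\<exists>u\<in>pverts F. tail G (g e) = f u" "\<exists>v\<in>pverts F. head G (g e) = f v"
        "g e \<in> arcs G" if "e \<in> parcs F" for e
      using that g F.wellformed' by (cases e; blast)+
    ultimately have "{e \<in> arcs G. tail G e \<in> f ` pverts F \<and> head G e \<in> f ` pverts F} = g ` parcs F"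
      by (intro set_eqI iffI) (auto simp: image_iff)
    then show ?thesis by (simp add: induce_subgraph_def app_iso_def)
  qed
  ultimately show ?thesis
    unfolding contains_induced_def digraph_iso_def using sub induced_induce by blast
qed

end

text \<open>Forgets the arc map of an isomorphism; what follows only depends on which vertices are
  adjacent.\<close>

lemma digraph_iso_with_projE:
  assumes "digraph_iso (with_proj F) H"
  obtains f where "inj_on f (pverts F)" "verts H = f ` pverts F"
    "arcs_ends H = map_prod f f ` parcs F"
proof -
  obtain h where h: "pre_digraph.digraph_isomorphism (with_proj F) h" "H = app_iso h (with_proj F)"
    using assms by (auto simp: digraph_iso_def)
  interpret wf_digraph "with_proj F" using h(1) by (simp add: pre_digraph.digraph_isomorphism_def)
  show thesis
    using that[of "iso_verts h"] digraph_isomorphism_inj_on_verts[OF h(1)] arcs_ends_app_iso_eq[OF h(1)] h(2)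
    by (simp add: map_prod_def)
qed

section \<open>Paths and cycles\<close>

lemma pair_wf_digraph_path_graph: "pair_wf_digraph (path_graph k)"
  by unfold_locales (auto simp: path_graph_def)

lemma pair_wf_digraph_cycle_graph: "pair_wf_digraph (cycle_graph k)"
  by unfold_locales (auto simp: cycle_graph_def)

lemma less_4_iff: "i < 4 \<longleftrightarrow> i = 0 \<or> i = 1 \<or> i = 2 \<or> i = (3::nat)"
  by auto

lemma less_5_iff: "i < 5 \<longleftrightarrow> i = 0 \<or> i = 1 \<or> i = 2 \<or> i = 3 \<or> i = (4::nat)"
  by auto

lemma pverts_path_5: "pverts (path_graph 5) = {0, 1, 2, 3, 4}"
  by (auto simp: path_graph_def)

lemma parcs_path_5:
  "parcs (path_graph 5) = {(0, 1), (1, 0), (1, 2), (2, 1), (2, 3), (3, 2), (3, 4), (4, 3)}"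
  by (auto simp: path_graph_def less_5_iff)

lemma pverts_cycle_4: "pverts (cycle_graph 4) = {0, 1, 2, 3}"
  by (auto simp: cycle_graph_def)

lemma parcs_cycle_4:
  "parcs (cycle_graph 4) = {(0, 1), (1, 0), (1, 2), (2, 1), (2, 3), (3, 2), (3, 0), (0, 3)}"
  by (auto simp: cycle_graph_def less_4_iff)

text \<open>Every vertex of the pattern lies on one of its edges, hence in \<open>S\<close>, so
  non-edges of the restriction are non-edges of \<open>E\<close>.\<close>

lemma induced_P5_Restr: "induced_P5 (Restr E S) a b c d e \<Longrightarrow> induced_P5 E a b c d e"
  by (auto simp: induced_P5_def)

lemma induced_C4_Restr: "induced_C4 (Restr E S) a b c d \<Longrightarrow> induced_C4 E a b c d"
  by (auto simp: induced_C4_def)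

context graph
begin

lemma induced_P5_imp_contains:
  assumes "induced_P5 (arcs_ends G) a b c d e"
  shows "contains_induced G (with_proj (path_graph 5))"
proof -
  let ?E = "arcs_ends G"
  define f where "f i = [a, b, c, d, e] ! i" for i
  have f: "f 0 = a" "f 1 = b" "f 2 = c" "f 3 = d" "f 4 = e" by (simp_all add: f_def)
  have adj: "(a, b) \<in> ?E" "(b, c) \<in> ?E" "(c, d) \<in> ?E" "(d, e) \<in> ?E"
      "(b, a) \<in> ?E" "(c, b) \<in> ?E" "(d, c) \<in> ?E" "(e, d) \<in> ?E"
    using assms sym_arcs_ends unfolding induced_P5_def by (blast dest: symD)+
  have nadj: "(a, c) \<notin> ?E" "(a, d) \<notin> ?E" "(a, e) \<notin> ?E" "(b, d) \<notin> ?E" "(b, e) \<notin> ?E" "(c, e) \<notin> ?E"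
      "(c, a) \<notin> ?E" "(d, a) \<notin> ?E" "(e, a) \<notin> ?E" "(d, b) \<notin> ?E" "(e, b) \<notin> ?E" "(e, c) \<notin> ?E"
    using assms sym_arcs_ends unfolding induced_P5_def by (blast dest: symD)+
  have irr: "(x, x) \<notin> ?E" for x using adj_not_same by blast
  \<comment> \<open>Coinciding vertices would be adjacent to themselves or share all neighbours; the
    pattern excludes both.\<close>
  have dist: "distinct [a, b, c, d, e]" using adj nadj irr by auto
  show ?thesis
  proof (rule contains_inducedI[OF pair_wf_digraph_path_graph])
    show "inj_on f (pverts (path_graph 5))"
      using dist f by (simp add: pverts_path_5)
    show "f ` pverts (path_graph 5) \<subseteq> verts G"
      using adj f by (auto simp: pverts_path_5 dest: adj_in_verts)
    show "(u, v) \<in> parcs (path_graph 5) \<longleftrightarrow> (f u, f v) \<in> ?E"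
      if "u \<in> pverts (path_graph 5)" "v \<in> pverts (path_graph 5)" for u v
      using that adj nadj irr f unfolding parcs_path_5 pverts_path_5 by auto
  qed
qed

lemma induced_C4_imp_contains:
  assumes "induced_C4 (arcs_ends G) a b c d"
  shows "contains_induced G (with_proj (cycle_graph 4))"
proof -
  let ?E = "arcs_ends G"
  define f where "f i = [a, b, c, d] ! i" for i
  have f: "f 0 = a" "f 1 = b" "f 2 = c" "f 3 = d" by (simp_all add: f_def)
  have adj: "(a, b) \<in> ?E" "(b, c) \<in> ?E" "(c, d) \<in> ?E" "(d, a) \<in> ?E"
      "(b, a) \<in> ?E" "(c, b) \<in> ?E" "(d, c) \<in> ?E" "(a, d) \<in> ?E"
    using assms sym_arcs_ends unfolding induced_C4_def by (blast dest: symD)+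
  have nadj: "(a, c) \<notin> ?E" "(b, d) \<notin> ?E" "(c, a) \<notin> ?E" "(d, b) \<notin> ?E"
    using assms sym_arcs_ends unfolding induced_C4_def by (blast dest: symD)+
  have irr: "(x, x) \<notin> ?E" for x using adj_not_same by blast
  have dist: "distinct [a, b, c, d]" using adj irr assms by (auto simp: induced_C4_def)
  show ?thesis
  proof (rule contains_inducedI[OF pair_wf_digraph_cycle_graph])
    show "inj_on f (pverts (cycle_graph 4))"
      using dist f by (simp add: pverts_cycle_4)
    show "f ` pverts (cycle_graph 4) \<subseteq> verts G"
      using adj f by (auto simp: pverts_cycle_4 dest: adj_in_verts)
    show "(u, v) \<in> parcs (cycle_graph 4) \<longleftrightarrow> (f u, f v) \<in> ?E"
      if "u \<in> pverts (cycle_graph 4)" "v \<in> pverts (cycle_graph 4)" for u v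
      using that adj nadj irr f unfolding parcs_cycle_4 pverts_cycle_4 by auto
  qed
qed

section \<open>The ratio bound, and a criterion for its failure\<close>

lemma connected_vertex_cover_number_bound:
  assumes "P5_C4_free (arcs_ends G)"
  shows "real (\<tau>\<^sub>c G) \<le> 4 / 3 * real (\<tau> G)"
proof -
  interpret P5_C4_free "arcs_ends G" by fact
  obtain X where X: "vertex_cover G X" "card X = \<tau> G" by (rule minimum_vertex_cover)
  have "finite X" using X finite_subset[OF _ finite_verts] by (auto simp: vertex_cover_def)
  then obtain C where C: "C \<subseteq> Field (arcs_ends G)" "covers (arcs_ends G) C"
      "\<forall>u\<in>C. \<forall>v\<in>C. (u, v) \<in> (arcs_ends G)\<^sup>* \<longrightarrow> (u, v) \<in> (Restr (arcs_ends G) C)\<^sup>*"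
      "3 * card C \<le> 4 * card X"
    using linked_cover_exists[of X] X by (auto simp: vertex_cover_iff_covers)
  then have "connected_vertex_cover G C" by (intro connected_vertex_coverI) auto
  then have "3 * \<tau>\<^sub>c G \<le> 4 * \<tau> G" using connected_vertex_cover_number_le[of C] C(4) X by linarith
  then show ?thesis by linarith
qed

text \<open>\<open>D\<close> shows that \<open>\<tau>\<close> is at most 2. Covers that small are
  edgeless on at least two vertices, hence disconnected, so \<open>\<tau>\<^sub>c\<close> is at
  least 3, which exceeds 8/3.\<close>

lemma ratio_gt_if_small_covers_independent:
  assumes conn: "Digraph_Component.connected G" and Field: "Field (arcs_ends G) = verts G"
    and D: "vertex_cover G D" "card D \<le> 2"
    and small: "\<And>C. vertex_cover G C \<Longrightarrow> card C \<le> 2 \<Longrightarrow>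
      Restr (arcs_ends G) C = {} \<and> (\<exists>u\<in>C. \<exists>v\<in>C. u \<noteq> v)"
  shows "\<not> real (\<tau>\<^sub>c G) \<le> 4 / 3 * real (\<tau> G)"
proof -
  have conn': "Digraph_Component.connected (remove_isolated G)"
    using conn Field
    by (simp add: remove_isolated_def Field_arcs_ends induce_eq_iff_induced[OF induced_subgraph_refl])
  \<comment> \<open>This provides some connected vertex cover, so that the minimum is
    attained.\<close>
  have "connected_vertex_cover G (verts G)"
  proof (rule connected_vertex_coverI)
    have "Restr (arcs_ends G) (verts G) = arcs_ends G" using adj_in_verts by auto
    then show "(u, v) \<in> (Restr (arcs_ends G) (verts G))\<^sup>*" if "(u, v) \<in> (arcs_ends G)\<^sup>*" for u v
      using that by simp
    show "covers (arcs_ends G) (verts G)" using adj_in_verts by (auto simp: covers_def)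
  qed (simp add: Field)
  then obtain C where C: "connected_vertex_cover G C" "card C = \<tau>\<^sub>c G"
    by (rule minimum_connected_vertex_cover)
  have "\<not> card C \<le> 2"
  proof
    assume "card C \<le> 2"
    moreover have vc: "vertex_cover G C" using C by (simp add: connected_vertex_cover_def)
    ultimately obtain u v where no_arc: "Restr (arcs_ends G) C = {}" and uv: "u \<in> C" "v \<in> C" "u \<noteq> v"
      using small by blast
    interpret HC: graph "G \<restriction> C"
      using vc by (intro graph_induced induced_induce) (simp add: vertex_cover_def)
    have "Digraph_Component.connected (G \<restriction> C)"
      using C conn' by (simp add: connected_vertex_cover_def)
    then have "(u, v) \<in> (Restr (arcs_ends G) C)\<^sup>*"
      using uv by (simp add: HC.connected_iff arcs_ends_induce)
    then show False using no_arc uv by simp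
  qed
  moreover have "\<tau> G \<le> 2" using vertex_cover_number_le[OF D(1)] D(2) by simp
  ultimately show ?thesis using C by linarith
qed

lemma connected_if_reach:
  assumes "r \<in> verts G" "\<And>v. v \<in> verts G \<Longrightarrow> (r, v) \<in> (arcs_ends G)\<^sup>*"
  shows "Digraph_Component.connected G"
proof -
  have "(v, r) \<in> (arcs_ends G)\<^sup>*" if "v \<in> verts G" for v
    using sym_rtrancl[OF sym_arcs_ends] assms(2)[OF that] by (rule symD)
  then show ?thesis using assms by (auto simp: connected_iff intro: rtrancl_trans)
qed

end

lemma card_le_2D:
  assumes "card C \<le> 2" "finite C" "x \<in> C" "y \<in> C" "z \<in> C" "distinct [x, y, z]"
  shows False
  using card_mono[of C "{x, y, z}"] assms by auto

text \<open>The second and fourth vertex form the only cover of P5 with at most two vertices, and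
  they are nonadjacent.\<close>

lemma path_5_ratio:
  assumes "graph H" "digraph_iso (with_proj (path_graph 5)) H"
  shows "\<not> real (\<tau>\<^sub>c H) \<le> 4 / 3 * real (\<tau> H)"
proof -
  interpret graph H by fact
  obtain f where f: "inj_on f (pverts (path_graph 5))" "verts H = f ` pverts (path_graph 5)"
    "arcs_ends H = map_prod f f ` parcs (path_graph 5)"
    using assms(2) by (rule digraph_iso_with_projE)
  define a b c d e where "a = f 0" "b = f 1" "c = f 2" "d = f 3" "e = f 4"
  note abcde = this
  have dist: "distinct [a, b, c, d, e]"
    using f(1) unfolding pverts_path_5 abcde by (auto simp: inj_on_def)
  have V: "verts H = {a, b, c, d, e}" unfolding f(2) pverts_path_5 abcde by simp
  have E: "arcs_ends H = {(a, b), (b, a), (b, c), (c, b), (c, d), (d, c), (d, e), (e, d)}"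
    unfolding f(3) parcs_path_5 abcde by simp
  show ?thesis
  proof (rule ratio_gt_if_small_covers_independent)
    show "Digraph_Component.connected H"
    proof (rule connected_if_reach)
      have "(a, b) \<in> (arcs_ends H)\<^sup>*" by (rule r_into_rtrancl) (simp add: E)
      moreover from this have "(a, c) \<in> (arcs_ends H)\<^sup>*" by (rule rtrancl_into_rtrancl) (simp add: E)
      moreover from this have "(a, d) \<in> (arcs_ends H)\<^sup>*" by (rule rtrancl_into_rtrancl) (simp add: E)
      moreover from this have "(a, e) \<in> (arcs_ends H)\<^sup>*" by (rule rtrancl_into_rtrancl) (simp add: E)
      ultimately show "(a, v) \<in> (arcs_ends H)\<^sup>*" if "v \<in> verts H" for v using that V by auto
    qed (simp add: V)
    show "Field (arcs_ends H) = verts H" unfolding V E by (auto simp: Field_def)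
    show "vertex_cover H {b, d}" by (simp add: vertex_cover_iff_covers covers_def V E)
    show "card {b, d} \<le> 2" by (simp add: card_insert_if)
    fix C assume C: "vertex_cover H C" "card C \<le> 2"
    have fin: "finite C" and sub: "C \<subseteq> {a, b, c, d, e}"
      using C V by (auto simp: vertex_cover_def intro: finite_subset)
    have cov: "a \<in> C \<or> b \<in> C" "b \<in> C \<or> c \<in> C" "c \<in> C \<or> d \<in> C" "d \<in> C \<or> e \<in> C"
      using C by (simp_all add: vertex_cover_iff_covers covers_def E)
    note no3 = card_le_2D[OF C(2) fin]
    \<comment> \<open>Without \<open>b\<close>, a cover contains \<open>a\<close>, \<open>c\<close>
      and one of \<open>d\<close>, \<open>e\<close>, which is too many. The mirror image gives
      \<open>d\<close>.\<close>
    have "b \<in> C" using cov no3[of a c d] no3[of a c e] dist by auto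
    moreover have "d \<in> C" using cov no3[of e c b] no3[of e c a] dist by auto
    ultimately have "C = {b, d}" using no3[of a b d] no3[of c b d] no3[of e b d] sub dist by auto
    then show "Restr (arcs_ends H) C = {} \<and> (\<exists>u\<in>C. \<exists>v\<in>C. u \<noteq> v)"
      using dist by (auto simp: E)
  qed
qed

text \<open>At most two vertices cover C4 only as a pair of opposite, hence nonadjacent,
  ones.\<close>

lemma cycle_4_ratio:
  assumes "graph H" "digraph_iso (with_proj (cycle_graph 4)) H"
  shows "\<not> real (\<tau>\<^sub>c H) \<le> 4 / 3 * real (\<tau> H)"
proof -
  interpret graph H by fact
  obtain f where f: "inj_on f (pverts (cycle_graph 4))" "verts H = f ` pverts (cycle_graph 4)"
    "arcs_ends H = map_prod f f ` parcs (cycle_graph 4)"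
    using assms(2) by (rule digraph_iso_with_projE)
  define a b c d where "a = f 0" "b = f 1" "c = f 2" "d = f 3"
  note abcd = this
  have dist: "distinct [a, b, c, d]"
    using f(1) unfolding pverts_cycle_4 abcd by (auto simp: inj_on_def)
  have V: "verts H = {a, b, c, d}" unfolding f(2) pverts_cycle_4 abcd by simp
  have E: "arcs_ends H = {(a, b), (b, a), (b, c), (c, b), (c, d), (d, c), (d, a), (a, d)}"
    unfolding f(3) parcs_cycle_4 abcd by simp
  show ?thesis
  proof (rule ratio_gt_if_small_covers_independent)
    show "Digraph_Component.connected H"
    proof (rule connected_if_reach)
      have "(a, b) \<in> (arcs_ends H)\<^sup>*" by (rule r_into_rtrancl) (simp add: E)
      moreover from this have "(a, c) \<in> (arcs_ends H)\<^sup>*" by (rule rtrancl_into_rtrancl) (simp add: E)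
      moreover from this have "(a, d) \<in> (arcs_ends H)\<^sup>*" by (rule rtrancl_into_rtrancl) (simp add: E)
      ultimately show "(a, v) \<in> (arcs_ends H)\<^sup>*" if "v \<in> verts H" for v using that V by auto
    qed (simp add: V)
    show "Field (arcs_ends H) = verts H" unfolding V E by (auto simp: Field_def)
    show "vertex_cover H {b, d}" by (simp add: vertex_cover_iff_covers covers_def V E)
    show "card {b, d} \<le> 2" by (simp add: card_insert_if)
    fix C assume C: "vertex_cover H C" "card C \<le> 2"
    have fin: "finite C" and sub: "C \<subseteq> {a, b, c, d}"
      using C V by (auto simp: vertex_cover_def intro: finite_subset)
    have cov: "a \<in> C \<or> b \<in> C" "b \<in> C \<or> c \<in> C" "c \<in> C \<or> d \<in> C" "d \<in> C \<or> a \<in> C"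
      using C by (simp_all add: vertex_cover_iff_covers covers_def E)
    note no3 = card_le_2D[OF C(2) fin]
    have "C = {a, c} \<or> C = {b, d}"
      using cov no3[of a b c] no3[of a b d] no3[of a c d] no3[of b c d] sub dist by auto
    then show "Restr (arcs_ends H) C = {} \<and> (\<exists>u\<in>C. \<exists>v\<in>C. u \<noteq> v)"
      using dist by (auto simp: E)
  qed
qed

theorem theorem3:
  fixes G :: "('a, 'b) pre_digraph"
  assumes "graph G"
  shows "(\<forall>H. induced_subgraph H G \<longrightarrow> real (\<tau>\<^sub>c H) \<le> 4 / 3 * real (\<tau> H)) \<longleftrightarrow>
    \<not> contains_induced G (with_proj (path_graph 5)) \<and>
    \<not> contains_induced G (with_proj (cycle_graph 4))"
proof -
  interpret G: graph G by fact
  show ?thesis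
  proof
    assume "\<forall>H. induced_subgraph H G \<longrightarrow> real (\<tau>\<^sub>c H) \<le> 4 / 3 * real (\<tau> H)"
    \<comment> \<open>A copy of either forbidden graph is itself an induced subgraph that exceeds
      the ratio.\<close>
    then show "\<not> contains_induced G (with_proj (path_graph 5)) \<and>
        \<not> contains_induced G (with_proj (cycle_graph 4))"
      using path_5_ratio cycle_4_ratio G.graph_induced unfolding contains_induced_def by blast
  next
    assume free: "\<not> contains_induced G (with_proj (path_graph 5)) \<and>
      \<not> contains_induced G (with_proj (cycle_graph 4))"
    show "\<forall>H. induced_subgraph H G \<longrightarrow> real (\<tau>\<^sub>c H) \<le> 4 / 3 * real (\<tau> H)"
    proof (intro allI impI)
      fix H assume H: "induced_subgraph H G"
      interpret H: graph H using H by (rule G.graph_induced)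
      \<comment> \<open>Adjacency in \<open>H\<close> is a restriction of that in \<open>G\<close>,
        so the excluded patterns are absent from \<open>H\<close> as well.\<close>
      have "arcs_ends H = Restr (arcs_ends G) (verts H)"
        using arcs_ends_induce[of G "verts H"] by (simp add: G.induce_eq_iff_induced[OF H])
      then have "\<not> induced_P5 (arcs_ends H) a b c d e" "\<not> induced_C4 (arcs_ends H) a b c d" for a b c d e
        using free G.induced_P5_imp_contains[of a b c d e] G.induced_C4_imp_contains[of a b c d]
          induced_P5_Restr[of "arcs_ends G" "verts H" a b c d e]
          induced_C4_Restr[of "arcs_ends G" "verts H" a b c d] by auto
      then have "P5_C4_free (arcs_ends H)"
        using H.sym_arcs_ends H.irrefl_arcs_ends by unfold_locales
      then show "real (\<tau>\<^sub>c H) \<le> 4 / 3 * real (\<tau> H)" by (rule H.connected_vertex_cover_number_bound)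
    qed
  qed
qed

end
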